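(* Let $n,k$ be nonnegative integers, let $s\ge 1$, and let $\ell$ be an integer with $0\le \ell<s+1$ and $\gcd(\ell,s+1)=1$. Let $r\in\{0,1,\dots,s\}$ be the remainder of $k\ell^{-1}$ upon division by $s+1$ (where $\ell^{-1}$ is the inverse of $\ell$ modulo $s+1$). Then \[ M^{(s,\ell)}_k(1,\dots ,n)=\sum _{i = 0}^{\min \{\lfloor \frac{n-r}{s+1}\rfloor ,\lfloor \frac{k}{s+1}\rfloor - \lfloor \frac{r \ell}{s+1}\rfloor \}}h_{\lfloor \frac{k}{s+1}\rfloor -\lfloor \frac{r \ell}{s+1}\rfloor -i \ell}(1^{s+1},\dots ,n^{s+1})\left [{n+1\atop n+1-r-i (s+1)}\right ]_\ell . \]
   Context: For $0\le\ell<s+1$, the $\ell$-modular symmetric function is $M_k^{(s,\ell)}(x_1,\dots ,x_n)=\sum x_1^{j_1}\cdots x_n^{j_n}$, the sum over all $n$-tuples of nonnegative integers $(j_1,\dots,j_n)$ with $j_1+\cdots+j_n=k$ and each $j_i\equiv 0$ or $j_i\equiv \ell \pmod{s+1}$. $h_m$ is the complete homogeneous symmetric polynomial of degree $m$, with $h_0=1$ and $h_m=0$ for $m<0$. The Stirling numbers of the first kind of higher level $\ell$, $\left[{N\atop j}\right]_\ell$, are defined by $x(x+1^\ell)(x+2^\ell)\cdots(x+(N-1)^\ell)=\sum_{j=0}^N \left[{N\atop j}\right]_\ell x^j$ for $N\ge0$ (the empty product being $1$). *)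

theory Defs
  imports "HOL-Number_Theory.Number_Theory" "HOL-Computational_Algebra.Polynomial"
begin

text \<open>
  The symmetric functions are given by their values at \<open>x 1, \<dots>, x n\<close>. An exponent tuple
  \<open>(j\<^sub>1, \<dots>, j\<^sub>n)\<close> is an extensional function on \<open>{1..n}\<close>, so that distinct functions
  represent distinct tuples; for \<open>n = 0\<close> there is exactly one (empty) tuple.
\<close>

definition modular_sym ::
  "nat \<Rightarrow> nat \<Rightarrow> nat \<Rightarrow> nat \<Rightarrow> (nat \<Rightarrow> 'a :: comm_semiring_1) \<Rightarrow> 'a" where
  "modular_sym s l k n x =
     (\<Sum>j\<in>{j \<in> {1..n} \<rightarrow>\<^sub>E UNIV. (\<Sum>i\<in>{1..n}. j i) = k \<and>
              (\<forall>i\<in>{1..n}. [j i = 0] (mod (s + 1)) \<or> [j i = l] (mod (s + 1)))}.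
        \<Prod>i\<in>{1..n}. x i ^ j i)"

text \<open>The degree is an integer; for a negative degree there are no monomials and the sum is \<open>0\<close>.\<close>

definition complete_sym :: "int \<Rightarrow> nat \<Rightarrow> (nat \<Rightarrow> 'a :: comm_semiring_1) \<Rightarrow> 'a" where
  "complete_sym m n x =
     (\<Sum>j\<in>{j \<in> {1..n} \<rightarrow>\<^sub>E (UNIV :: nat set). int (\<Sum>i\<in>{1..n}. j i) = m}.
        \<Prod>i\<in>{1..n}. x i ^ j i)"

text \<open>
  The polynomial \<open>X (X + 1\<^sup>l) (X + 2\<^sup>l) \<dots> (X + (N - 1)\<^sup>l)\<close>. Its first factor is \<open>X\<close> also for
  \<open>l = 0\<close>, and hence is not written as \<open>X + 0\<^sup>l\<close>.
\<close>

definition stirling1_level_poly :: "nat \<Rightarrow> nat \<Rightarrow> int poly" where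
  "stirling1_level_poly l N =
     (if N = 0 then 1 else [:0, 1:] * (\<Prod>i\<in>{1..<N}. [:int i ^ l, 1:]))"

definition stirling1_level :: "nat \<Rightarrow> nat \<Rightarrow> nat \<Rightarrow> int" where
  "stirling1_level l N j = coeff (stirling1_level_poly l N) j"

text \<open>The index sets above are finite, so neither sum is \<open>0\<close> merely by the convention for
  sums over infinite sets.\<close>

lemma finite_exponents:
  fixes n k :: nat
  shows "finite {j \<in> {1..n} \<rightarrow>\<^sub>E (UNIV :: nat set). (\<Sum>i\<in>{1..n}. j i) = k}"
proof (rule finite_subset)
  show "{j \<in> {1..n} \<rightarrow>\<^sub>E (UNIV :: nat set). (\<Sum>i\<in>{1..n}. j i) = k} \<subseteq> {1..n} \<rightarrow>\<^sub>E {..k}"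
  proof
    fix j :: "nat \<Rightarrow> nat"
    assume "j \<in> {j \<in> {1..n} \<rightarrow>\<^sub>E (UNIV :: nat set). (\<Sum>i\<in>{1..n}. j i) = k}"
    then have j: "j \<in> {1..n} \<rightarrow>\<^sub>E UNIV" and s: "(\<Sum>i\<in>{1..n}. j i) = k"
      by auto
    have "j i \<le> k" if "i \<in> {1..n}" for i
      using member_le_sum[of i "{1..n}" j] that s by simp
    then show "j \<in> {1..n} \<rightarrow>\<^sub>E {..k}"
      using j by (auto simp: PiE_def)
  qed
qed (intro finite_PiE; simp)

lemma degree_stirling1_level_poly: "degree (stirling1_level_poly l N) = N"
proof (cases "N = 0")
  case False
  have deg: "degree (\<Prod>i\<in>{1..<N}. [:int i ^ l, 1:]) = N - 1"
    by (subst degree_prod_eq_sum_degree) auto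
  have "(\<Prod>i\<in>{1..<N}. [:int i ^ l, 1:]) \<noteq> 0"
    by auto
  then have "degree ([:0, 1:] * (\<Prod>i\<in>{1..<N}. [:int i ^ l, 1:])) = N"
    using False deg by (subst degree_mult_eq) auto
  then show ?thesis
    using False by (simp add: stirling1_level_poly_def)
qed (simp add: stirling1_level_poly_def)

lemma stirling1_level_expansion:
  "poly (stirling1_level_poly l N) x = (\<Sum>j\<le>N. stirling1_level l N j * x ^ j)"
  by (simp add: poly_altdef degree_stirling1_level_poly stirling1_level_def)

end

theory Submission
  imports Defs "HOL-Computational_Algebra.Formal_Laurent_Series"
begin

text \<open>
  The generating function of \<open>M\<^sub>k\<close> in a variable \<open>t\<close> is the product over \<open>i\<close> of
  \<open>(1 + x\<^sub>i\<^sup>l t\<^sup>l) / (1 - x\<^sub>i\<^bsup>s+1\<^esup> t\<^bsup>s+1\<^esup>)\<close>. Hence \<open>M\<^sub>k\<close> is the sum of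
  \<open>e\<^sub>a(x\<^sup>l) h\<^sub>b(x\<^bsup>s+1\<^esup>)\<close> over \<open>a l + b (s + 1) = k\<close>. Since \<open>l\<close> is invertible modulo
  \<open>s + 1\<close>, this forces \<open>a = r + i (s + 1)\<close>, and \<open>e\<^sub>a(1\<^sup>l, \<dots>, n\<^sup>l)\<close> is a Stirling number
  of level \<open>l\<close>.
\<close>

text \<open>An iterated Cauchy product. Indexing by extensional functions makes the sum match the
  index sets of \<open>modular_sym\<close> and \<open>complete_sym\<close>.\<close>

lemma fps_nth_prod_PiE:
  fixes F :: "'i \<Rightarrow> 'a :: comm_semiring_1 fps"
  assumes "finite A"
  shows "fps_nth (\<Prod>i\<in>A. F i) k =
    (\<Sum>j\<in>{j \<in> A \<rightarrow>\<^sub>E UNIV. (\<Sum>i\<in>A. j i) = k}. \<Prod>i\<in>A. fps_nth (F i) (j i))"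
  using assms
proof (induction A arbitrary: k)
  case empty
  have "{j \<in> {} \<rightarrow>\<^sub>E (UNIV :: nat set). (\<Sum>i\<in>({} :: 'i set). j i) = k} =
      (if k = 0 then {\<lambda>_. undefined} else {})"
    by auto
  then show ?case by (auto split: if_splits)
next
  case (insert a A)
  let ?S = "\<lambda>m. {j \<in> A \<rightarrow>\<^sub>E (UNIV :: nat set). (\<Sum>i\<in>A. j i) = m}"
  let ?T = "{j \<in> insert a A \<rightarrow>\<^sub>E (UNIV :: nat set). (\<Sum>i\<in>insert a A. j i) = k}"
  have fin: "finite (?S m)" for m
  proof (rule finite_subset)
    show "?S m \<subseteq> A \<rightarrow>\<^sub>E {..m}"
      using insert.hyps by (auto simp: PiE_iff extensional_def intro: member_le_sum)
  qed (use insert.hyps in \<open>simp add: finite_PiE\<close>)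
  have upd: "sum (j(a := d)) A = sum j A"
    "(\<Prod>i\<in>A. fps_nth (F i) ((j(a := d)) i)) = (\<Prod>i\<in>A. fps_nth (F i) (j i))" for j d
    using insert.hyps by (auto intro: sum.cong prod.cong)
  have "fps_nth (\<Prod>i\<in>insert a A. F i) k =
      (\<Sum>d=0..k. \<Sum>j\<in>?S (k - d). fps_nth (F a) d * (\<Prod>i\<in>A. fps_nth (F i) (j i)))"
    using insert by (simp add: fps_mult_nth sum_distrib_left)
  also have "\<dots> = (\<Sum>(d, j)\<in>(SIGMA d:{0..k}. ?S (k - d)).
      fps_nth (F a) d * (\<Prod>i\<in>A. fps_nth (F i) (j i)))"
    by (rule sum.Sigma) (use fin in auto)
  also have "\<dots> = (\<Sum>j\<in>?T. \<Prod>i\<in>insert a A. fps_nth (F i) (j i))"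
  \<comment> \<open>A tuple on \<open>insert a A\<close> amounts to its exponent \<open>d\<close> at
    \<open>a\<close> and its restriction to \<open>A\<close>; resetting the value at
    \<open>a\<close> to \<open>undefined\<close> makes the restriction extensional.\<close>
  proof (rule sum.reindex_bij_witness
      [where i = "\<lambda>j. (j a, j(a := undefined))" and j = "\<lambda>(d, j). j(a := d)"])
    fix p assume "p \<in> (SIGMA d:{0..k}. ?S (k - d))"
    then obtain d j where p: "p = (d, j)" "d \<le> k" "j \<in> A \<rightarrow>\<^sub>E UNIV" "sum j A = k - d"
      by auto
    have undef: "j(a := undefined) = j"
      using p insert.hyps by (auto simp: PiE_iff extensional_def)
    have "sum (j(a := d)) (insert a A) = k"
      unfolding sum.insert[OF insert.hyps] upd using p by simp
    then show "(case p of (d, j) \<Rightarrow> j(a := d)) \<in> ?T"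
      using p by (simp del: sum.insert add: fun_upd_in_PiE PiE_iff extensional_def)
    show "(\<lambda>j. (j a, j(a := undefined))) (case p of (d, j) \<Rightarrow> j(a := d)) = p"
      using p undef by simp
    show "(\<Prod>i\<in>insert a A. fps_nth (F i) ((case p of (d, j) \<Rightarrow> j(a := d)) i)) =
        (case p of (d, j) \<Rightarrow> fps_nth (F a) d * (\<Prod>i\<in>A. fps_nth (F i) (j i)))"
      unfolding p(1) split prod.insert[OF insert.hyps] upd by simp
  next
    fix j assume "j \<in> ?T"
    then show "(j a, j(a := undefined)) \<in> (SIGMA d:{0..k}. ?S (k - d))"
      using insert.hyps upd(1)[of j undefined] by (auto simp: PiE_iff extensional_def)
  qed auto
  finally show ?case .
qed

lemma complete_sym_of_nat:
  fixes x :: "nat \<Rightarrow> 'a :: comm_semiring_1"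
  shows "complete_sym (int m) n x = fps_nth (\<Prod>i\<in>{1..n}. Abs_fps (\<lambda>j. x i ^ j)) m"
  by (simp add: complete_sym_def fps_nth_prod_PiE flip: of_nat_sum)

lemma complete_sym_neg: "m < 0 \<Longrightarrow> complete_sym m n x = 0"
proof -
  assume "m < 0"
  then have "{j \<in> {1..n} \<rightarrow>\<^sub>E (UNIV :: nat set). int (\<Sum>i\<in>{1..n}. j i) = m} = {}"
    by (auto simp del: of_nat_sum)
  then show ?thesis by (simp only: complete_sym_def sum.empty)
qed

lemma modular_sym_eq_fps_nth:
  "modular_sym s l k n x = fps_nth (\<Prod>i\<in>{1..n}. Abs_fps
     (\<lambda>j. if [j = 0] (mod (s + 1)) \<or> [j = l] (mod (s + 1)) then x i ^ j else 0)) k"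
  unfolding modular_sym_def fps_nth_prod_PiE[OF finite_atLeastAtMost]
  \<comment> \<open>A tuple with a forbidden exponent contributes a zero factor, so the sum may run
    over all tuples of total \<open>k\<close>.\<close>
  by (rule sum.mono_neutral_cong_left[OF finite_exponents]) (auto intro!: prod_zero prod.cong)

text \<open>The geometric series collects the multiples of \<open>s + 1\<close>, and its shift by
  \<open>l\<close> the residue class of \<open>l\<close>. Writing both factors as compositions lets
  the products over the variables be formed before the substitution.\<close>

lemma modular_factor_fps:
  fixes x :: "'a :: idom"
  assumes "0 < l" "l < s + 1"
  shows "Abs_fps (\<lambda>j. if [j = 0] (mod (s + 1)) \<or> [j = l] (mod (s + 1)) then x ^ j else 0) =
    (fps_of_poly [:1, x ^ l:] oo fps_X ^ l) * (Abs_fps (\<lambda>j. (x ^ (s + 1)) ^ j) oo fps_X ^ (s + 1))"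
proof (rule fps_ext)
  fix j
  let ?G = "Abs_fps (\<lambda>j. (x ^ (s + 1)) ^ j) oo fps_X ^ (s + 1)"
  have pow: "(x ^ (s + 1)) ^ (m div (s + 1)) = x ^ m" if "(s + 1) dvd m" for m
    unfolding power_mult[symmetric] using that by (simp only: dvd_mult_div_cancel)
  have G: "fps_nth ?G m = (if (s + 1) dvd m then x ^ m else 0)" for m
    by (simp only: fps_nth_compose_X_power fps_nth_Abs_fps pow cong: if_cong)
  have "fps_of_poly [:1, x ^ l:] oo fps_X ^ l = 1 + fps_const (x ^ l) * fps_X ^ l"
    using assms by (simp add: fps_of_poly_pCons fps_compose_add_distrib fps_compose_mult_distrib)
  then have "fps_nth ((fps_of_poly [:1, x ^ l:] oo fps_X ^ l) * ?G) j =
      fps_nth ?G j + (if j < l then 0 else x ^ l * fps_nth ?G (j - l))"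
    by (simp add: distrib_right mult.assoc fps_X_power_mult_nth)
  moreover have "[j = 0] (mod (s + 1)) \<longleftrightarrow> (s + 1) dvd j"
    by (simp add: cong_0_iff)
  \<comment> \<open>As \<open>l < s + 1\<close>, \<open>l\<close> is the least natural number in its
    residue class.\<close>
  moreover have "[j = l] (mod (s + 1)) \<longleftrightarrow> l \<le> j \<and> (s + 1) dvd (j - l)"
    using assms mod_eq_dvd_iff_nat[of l j "s + 1"]
    by (cases "l \<le> j") (auto simp: Cong.cong_def)
  \<comment> \<open>Otherwise \<open>s + 1\<close> would divide \<open>l\<close>; hence no exponent
    is counted twice.\<close>
  moreover have "\<not> ((s + 1) dvd j \<and> l \<le> j \<and> (s + 1) dvd (j - l))"
    using assms by (metis dvd_diffD1 nat_dvd_not_less)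
  moreover have "x ^ l * x ^ (j - l) = x ^ j" if "l \<le> j"
    using that by (simp flip: power_add)
  ultimately show "fps_nth (Abs_fps (\<lambda>j. if [j = 0] (mod (s + 1)) \<or> [j = l] (mod (s + 1))
      then x ^ j else 0)) j = fps_nth ((fps_of_poly [:1, x ^ l:] oo fps_X ^ l) * ?G) j"
    unfolding G by (auto simp del: power_Suc)
qed

text \<open>The coefficient at \<open>a\<close> is the elementary symmetric polynomial of degree
  \<open>a\<close> in the \<open>x i ^ l\<close>. It accounts for \<open>a * l\<close> of the degree
  \<open>k\<close>, and the complete symmetric part for the rest, in steps of
  \<open>s + 1\<close>.\<close>

lemma modular_sym_eq_sum:
  fixes x :: "nat \<Rightarrow> 'a :: idom"
  assumes "0 < l" "l < s + 1"
  shows "modular_sym s l k n x =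
    (\<Sum>a | a \<le> n \<and> a * l \<le> k \<and> (s + 1) dvd (k - a * l).
       coeff (\<Prod>i\<in>{1..n}. [:1, x i ^ l:]) a *
       complete_sym (int ((k - a * l) div (s + 1))) n (\<lambda>i. x i ^ (s + 1)))"
proof -
  let ?P = "\<Prod>i\<in>{1..n}. [:1, x i ^ l:]"
  let ?H = "\<Prod>i\<in>{1..n}. Abs_fps (\<lambda>j. (x i ^ (s + 1)) ^ j)"
  \<comment> \<open>Only an upper bound, since some \<open>x i\<close> may be zero.\<close>
  have "degree ?P \<le> (\<Sum>i\<in>{1..n}. degree [:1, x i ^ l:])"
    by (rule degree_prod_sum_le[unfolded o_def]) simp
  also have "\<dots> \<le> (\<Sum>i\<in>{1..n}. 1)"
    by (intro sum_mono) auto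
  finally have deg: "degree ?P \<le> n" by simp
  have "modular_sym s l k n x = fps_nth (\<Prod>i\<in>{1..n}. (fps_of_poly [:1, x i ^ l:] oo fps_X ^ l) *
      (Abs_fps (\<lambda>j. (x i ^ (s + 1)) ^ j) oo fps_X ^ (s + 1))) k"
    unfolding modular_sym_eq_fps_nth modular_factor_fps[OF assms] ..
  also have "\<dots> = fps_nth ((fps_of_poly ?P oo fps_X ^ l) * (?H oo fps_X ^ (s + 1))) k"
    \<comment> \<open>Composition is multiplicative here because both inner powers have positive
      exponent, hence zero constant term.\<close>
    using assms by (simp only: prod.distrib fps_of_poly_prod) (subst (1 2) fps_compose_prod_distrib, auto)
  also have "\<dots> = (\<Sum>d=0..k. (if l dvd d then coeff ?P (d div l) else 0) *
      (if (s + 1) dvd (k - d) then fps_nth ?H ((k - d) div (s + 1)) else 0))"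
    using assms by (simp only: fps_mult_nth fps_nth_compose_X_power fps_of_poly_nth)
  also have "\<dots> = (\<Sum>d | d \<le> k \<and> l dvd d \<and> d div l \<le> n \<and> (s + 1) dvd (k - d).
      coeff ?P (d div l) * fps_nth ?H ((k - d) div (s + 1)))"
  proof (intro sum.mono_neutral_cong_right ballI)
    fix d assume "d \<in> {0..k} - {d. d \<le> k \<and> l dvd d \<and> d div l \<le> n \<and> (s + 1) dvd (k - d)}"
    moreover have "coeff ?P (d div l) = 0" if "\<not> d div l \<le> n"
      using deg that by (intro coeff_eq_0) simp
    ultimately show "(if l dvd d then coeff ?P (d div l) else 0) *
        (if (s + 1) dvd (k - d) then fps_nth ?H ((k - d) div (s + 1)) else 0) = 0"
      by auto
  qed auto
  also have "\<dots> = (\<Sum>a | a \<le> n \<and> a * l \<le> k \<and> (s + 1) dvd (k - a * l).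
      coeff ?P a * fps_nth ?H ((k - a * l) div (s + 1)))"
    by (rule sum.reindex_bij_witness[where i = "\<lambda>a. a * l" and j = "\<lambda>d. d div l"])
      (use assms in auto)
  finally show ?thesis by (simp only: complete_sym_of_nat)
qed

text \<open>Reversing coefficients turns each \<open>[:c, 1:]\<close> into \<open>[:1, c:]\<close>.
  The extra factor \<open>[:0, 1:]\<close> of the Stirling polynomial shifts the index
  \<open>n - a\<close> to \<open>n + 1 - a\<close>.\<close>

lemma stirling1_level_eq_coeff:
  assumes "a \<le> n"
  shows "stirling1_level l (n + 1) (n + 1 - a) = coeff (\<Prod>i\<in>{1..n}. [:1, int i ^ l:]) a"
proof -
  let ?Q = "\<Prod>i\<in>{1..n}. [:int i ^ l, 1:]"
  have deg: "degree ?Q = n"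
    by (subst degree_prod_eq_sum_degree) auto
  have "reflect_poly [:c, 1:] = [:1, c:]" for c :: int
    by (simp add: reflect_poly_def)
  then have "(\<Prod>i\<in>{1..n}. [:1, int i ^ l:]) = reflect_poly ?Q"
    by (simp add: reflect_poly_prod)
  moreover have "{1..<n + 1} = {1..n}" by auto
  ultimately show ?thesis
    using assms deg by (simp add: stirling1_level_def stirling1_level_poly_def coeff_reflect_poly Suc_diff_le)
qed

text \<open>Stated for integers because it is applied to \<open>n - r\<close>, which may be
  negative.\<close>

lemma int_le_div_iff:
  fixes a b m :: int
  assumes "0 < m"
  shows "a \<le> b div m \<longleftrightarrow> a * m \<le> b"
proof
  assume "a \<le> b div m"
  then have "a * m \<le> b div m * m"
    using assms by (intro mult_right_mono) auto
  also have "\<dots> \<le> b"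
    using assms pos_mod_sign[of m b] div_mult_mod_eq[of b m] by linarith
  finally show "a * m \<le> b" .
next
  assume "a * m \<le> b"
  then show "a \<le> b div m"
    using zdiv_mono1[of "a * m" b m] assms by simp
qed

theorem theorem4p4:
  fixes n k s l r :: nat
  assumes "s \<ge> 1" and "l < s + 1" and "gcd l (s + 1) = 1"
    and "int r = (int k * modular_inverse (int (s + 1)) (int l)) mod int (s + 1)"
  shows "modular_sym s l k n (\<lambda>i. int i) =
    (\<Sum>i\<in>{0 .. min \<lfloor>(real n - real r) / real (s + 1)\<rfloor>
                  (\<lfloor>real k / real (s + 1)\<rfloor> - \<lfloor>real (r * l) / real (s + 1)\<rfloor>)}.
       complete_sym (\<lfloor>real k / real (s + 1)\<rfloor> - \<lfloor>real (r * l) / real (s + 1)\<rfloor> - i * int l)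
         n (\<lambda>a. int a ^ (s + 1)) *
       stirling1_level l (n + 1) (nat (int n + 1 - int r - i * int (s + 1))))"
proof -
  define m where "m = s + 1"
  define q where "q = int (k div m) - int ((r * l) div m)"
  define N where "N = (int n - int r) div int m"
  have m: "m > 0" and lm: "l < m"
    using assms(2) by (simp_all add: m_def)
  have cop: "coprime l m"
    using assms(3) unfolding m_def coprime_iff_gcd_eq_1 .
  \<comment> \<open>If \<open>l = 0\<close>, the gcd would be \<open>s + 1\<close>, which is at
    least 2.\<close>
  have l: "0 < l"
    using assms(1,3) by (cases "l = 0") simp_all
  have inv: "[modular_inverse (int m) (int l) * int l = 1] (mod int m)"
    using cop by (intro cong_modular_inverse2) (simp add: coprime_int_iff)
  have "[int r * int l = int k * modular_inverse (int m) (int l) * int l] (mod int m)"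
    using assms(4) by (intro cong_mult cong_refl) (simp add: m_def Cong.cong_def)
  also have "[int k * modular_inverse (int m) (int l) * int l = int k * 1] (mod int m)"
    unfolding mult.assoc by (intro cong_mult cong_refl inv)
  finally have rl: "[r * l = k] (mod m)"
    by (simp flip: cong_int_iff)
  have rm: "r < m"
    using assms(4) m by (simp add: m_def flip: of_nat_less_iff[where 'a = int])
  \<comment> \<open>By \<open>rl\<close>, \<open>k\<close> and \<open>r * l\<close> leave the same
    remainder modulo \<open>m\<close>, so they differ by \<open>m\<close> times the difference of
    their quotients.\<close>
  have k: "int k = int (r * l) + int m * q"
  proof -
    have "int k = int m * int (k div m) + int (k mod m)"
      and "int (r * l) = int m * int (r * l div m) + int (r * l mod m)"
      by (metis mult_div_mod_eq of_nat_add of_nat_mult)+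
    then show ?thesis using rl by (simp add: q_def Cong.cong_def right_diff_distrib)
  qed
  have le_N: "i \<le> N \<longleftrightarrow> int r + i * int m \<le> int n" for i
    using m by (simp add: N_def int_le_div_iff algebra_simps)
  have fl: "\<lfloor>(real n - real r) / real (s + 1)\<rfloor> = N"
    using floor_divide_of_int_eq[of "int n - int r" "int m", where 'a = real]
    by (simp add: N_def m_def)
  have fl': "\<lfloor>real k / real (s + 1)\<rfloor> - \<lfloor>real (r * l) / real (s + 1)\<rfloor> = q"
    unfolding q_def m_def floor_divide_of_nat_eq ..
  have idx: "int (k - a * l) = int m * (q - i * int l)"
    if "a * l \<le> k" "int a = int r + i * int m" for a i
    using that k by (simp add: of_nat_diff algebra_simps)
  have le_k: "a * l \<le> k \<longleftrightarrow> i * int l \<le> q" if "int a = int r + i * int m" for a i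
  proof -
    have "a * l \<le> k \<longleftrightarrow> (int r + i * int m) * int l \<le> int k"
      unfolding that[symmetric] by (simp flip: of_nat_mult)
    also have "\<dots> \<longleftrightarrow> int m * (i * int l) \<le> int m * q"
      unfolding k by (simp add: algebra_simps)
    finally show ?thesis using m by simp
  qed
  \<comment> \<open>Coprimality allows \<open>l\<close> to be cancelled from \<open>a * l\<close>
    and \<open>r * l\<close>, which are both congruent to \<open>k\<close>.\<close>
  have a_mod: "a mod m = r" if "a * l \<le> k" "m dvd (k - a * l)" for a
  proof -
    have "[a * l = k] (mod m)"
      using that by (metis cong_altdef_nat cong_sym)
    then have "[a * l = r * l] (mod m)"
      using rl cong_sym cong_trans by blast
    then have "[a = r] (mod m)"
      using cop by (simp add: cong_mult_rcancel_nat)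
    then show ?thesis using rm by (simp add: Cong.cong_def)
  qed
  let ?t = "\<lambda>i. complete_sym (q - i * int l) n (\<lambda>a. int a ^ m) *
      stirling1_level l (n + 1) (nat (int n + 1 - int r - i * int m))"
  let ?u = "\<lambda>a. coeff (\<Prod>i\<in>{1..n}. [:1, int i ^ l:]) a *
      complete_sym (int ((k - a * l) div m)) n (\<lambda>i. int i ^ m)"
  \<comment> \<open>Every contributing \<open>a\<close> has the form \<open>r + i * m\<close>; this
    provides one direction of the reindexing and the equality of the terms.\<close>
  have *: "int (a div m) \<in> {0..min N q} - {i \<in> {0..min N q}. q < i * int l} \<and>
      nat (int r + int (a div m) * int m) = a \<and> ?t (int (a div m)) = ?u a"
    if an: "a \<le> n" and ak: "a * l \<le> k" and dv: "m dvd (k - a * l)" for a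
  proof (intro conjI)
    define i where "i = int (a div m)"
    have a: "int a = int r + i * int m"
      using a_mod[OF ak dv] unfolding i_def
      by (metis mod_mult_div_eq mult.commute of_nat_add of_nat_mult)
    have il: "i * int l \<le> q" using ak le_k[OF a] by simp
    \<comment> \<open>Turns \<open>i * l \<le> q\<close> into the weaker bound
      \<open>i \<le> q\<close> of the summation range.\<close>
    moreover have "i * 1 \<le> i * int l" using l unfolding i_def by (intro mult_left_mono) auto
    moreover have "i \<ge> 0" by (simp add: i_def)
    ultimately show "int (a div m) \<in> {0..min N q} - {i \<in> {0..min N q}. q < i * int l}"
      using an a le_N[of i] unfolding i_def[symmetric] by auto
    show "nat (int r + int (a div m) * int m) = a"
      using a by (simp flip: i_def)
    have "int ((k - a * l) div m) = q - i * int l"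
      using m idx[OF ak a] by (simp add: zdiv_int)
    moreover have "nat (int n + 1 - int r - i * int m) = n + 1 - a"
      using a an by simp
    ultimately show "?t (int (a div m)) = ?u a"
      unfolding i_def[symmetric] using stirling1_level_eq_coeff[OF an, of l]
      by (simp only: mult.commute)
  qed
  have "modular_sym s l k n (\<lambda>i. int i) =
      (\<Sum>a | a \<le> n \<and> a * l \<le> k \<and> m dvd (k - a * l). ?u a)"
    using modular_sym_eq_sum[of l s k n int] l lm unfolding m_def by blast
  also have "\<dots> = (\<Sum>i\<in>{0..min N q}. ?t i)"
  \<comment> \<open>The range bounds \<open>i\<close> by \<open>q\<close>, but only
    \<open>i * l \<le> q\<close> comes from some \<open>a\<close>. The surplus indices give a
    complete symmetric polynomial of negative degree, hence zero.\<close>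
  proof (rule sum.reindex_bij_witness_not_neutral
      [where j = "\<lambda>a. int (a div m)" and i = "\<lambda>i. nat (int r + i * int m)"
       and S' = "{}" and T' = "{i \<in> {0..min N q}. q < i * int l}"])
    fix i assume "i \<in> {i \<in> {0..min N q}. q < i * int l}"
    then show "?t i = 0" by (simp add: complete_sym_neg)
  next
    fix i assume "i \<in> {0..min N q} - {i \<in> {0..min N q}. q < i * int l}"
    then have i: "0 \<le> i" "i \<le> N" "i * int l \<le> q" by auto
    define a where "a = nat (int r + i * int m)"
    have a: "int a = int r + i * int m" using i by (simp add: a_def)
    have "a * l \<le> k" using i le_k[OF a] by simp
    moreover from this have "m dvd (k - a * l)"
      using idx[OF _ a] by (metis dvd_triv_left of_nat_dvd_iff)
    moreover have "a \<le> n" using i a le_N[of i] by simp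
    \<comment> \<open>The quotient is exactly \<open>i\<close> because \<open>r < m\<close>.\<close>
    moreover have "int (a div m) = i"
      using rm m by (simp add: zdiv_int a div_add1_eq)
    ultimately show "int (nat (int r + i * int m) div m) = i"
      and "nat (int r + i * int m) \<in> {a. a \<le> n \<and> a * l \<le> k \<and> m dvd (k - a * l)} - {}"
      unfolding a_def by auto
  next
    fix a assume "a \<in> {a. a \<le> n \<and> a * l \<le> k \<and> m dvd (k - a * l)} - {}"
    then show "int (a div m) \<in> {0..min N q} - {i \<in> {0..min N q}. q < i * int l}"
      and "nat (int r + int (a div m) * int m) = a"
      using * by blast+
  next
    fix a assume "a \<in> {a. a \<le> n \<and> a * l \<le> k \<and> m dvd (k - a * l)}"
    then show "?t (int (a div m)) = ?u a"
      using * by blast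
  qed (auto intro: finite_subset[of _ "{0..N}"])
  finally show ?thesis
    unfolding fl fl' m_def .
qed

end
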